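(* For every finite simple graph $G$ of order $n$, $E(G)\geq 2\bigl(n-\chi(\overline{G})\bigr)$.
   Context: The energy $E(G)$ is the sum of the absolute values of all eigenvalues of the adjacency matrix of $G$; $\overline{G}$ is the complement of $G$ and $\chi$ denotes the chromatic number. *)

theory Defs
  imports
    "Graph_Theory.Pair_Digraph"
    "Jordan_Normal_Form.Spectral_Radius"
begin

text \<open>
  Finite simple graphs are the structures satisfying \<open>pair_graph\<close>: a finite vertex set
  together with a symmetric, irreflexive set of arcs, where an undirected edge \<open>{u, v}\<close> is
  represented by the two arcs \<open>(u, v)\<close> and \<open>(v, u)\<close>.
\<close>

definition complement :: "'a pair_pre_digraph \<Rightarrow> 'a pair_pre_digraph" where
  "complement G = \<lparr> pverts = pverts G,
     parcs = {(u, v). u \<in> pverts G \<and> v \<in> pverts G \<and> u \<noteq> v \<and> (u, v) \<notin> parcs G} \<rparr>"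

definition colorable :: "'a pair_pre_digraph \<Rightarrow> nat \<Rightarrow> bool" where
  "colorable G k \<longleftrightarrow>
     (\<exists>c. c ` pverts G \<subseteq> {..<k} \<and> (\<forall>(u, v) \<in> parcs G. c u \<noteq> c v))"

definition chromatic_number :: "'a pair_pre_digraph \<Rightarrow> nat" where
  "chromatic_number G = (LEAST k. colorable G k)"

text \<open>
  The adjacency matrix with respect to an enumeration \<open>vs\<close> of the vertices. It is taken over
  the complex numbers, so that its characteristic polynomial splits and no eigenvalue is missed.
\<close>

definition adjacency_mat :: "'a list \<Rightarrow> 'a pair_pre_digraph \<Rightarrow> complex mat" where
  "adjacency_mat vs G = mat (length vs) (length vs)
     (\<lambda>(i, j). if (vs ! i, vs ! j) \<in> parcs G then 1 else 0)"

text \<open>Eigenvalues are counted with algebraic multiplicity.\<close>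

definition mat_energy :: "complex mat \<Rightarrow> real" where
  "mat_energy A = (\<Sum>z \<in> spectrum A. real (Polynomial.order z (char_poly A)) * cmod z)"

text \<open>
  The choice of the enumeration is immaterial, see \<open>graph_energy_eq\<close> below.
\<close>

definition graph_energy :: "'a pair_pre_digraph \<Rightarrow> real" where
  "graph_energy G =
     mat_energy (adjacency_mat (SOME vs. distinct vs \<and> set vs = pverts G) G)"

lemma pair_graph_complement:
  assumes "pair_graph G"
  shows "pair_graph (complement G)"
proof -
  interpret pair_graph G by fact
  have "finite (parcs (complement G))"
    by (rule finite_subset[of _ "pverts G \<times> pverts G"])
       (auto simp: complement_def pair_finite_verts)
  moreover have "sym (parcs (complement G))"
    using pair_sym_arcs by (auto simp: complement_def symmetric_def sym_def)
  ultimately show ?thesis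
    by unfold_locales
       (auto simp: complement_def pair_finite_verts symmetric_def)
qed

lemma colorable_chromatic_number:
  assumes "pair_graph G"
  shows "colorable G (chromatic_number G)"
proof -
  interpret pair_graph G by fact
  obtain c where c: "bij_betw c (pverts G) {0..<card (pverts G)}"
    using ex_bij_betw_finite_nat[OF pair_finite_verts] by blast
  have "c u \<noteq> c v" if "(u, v) \<in> parcs G" for u v
    using that c in_arcsD1[OF that] in_arcsD2[OF that] no_loops'[OF that]
    by (auto simp: bij_betw_def dest: inj_onD)
  then have "colorable G (card (pverts G))"
    using c unfolding colorable_def bij_betw_def by (intro exI[of _ c]) auto
  then show ?thesis
    unfolding chromatic_number_def by (rule LeastI)
qed

lemma adjacency_mat_similar:
  assumes vs: "distinct vs" "set vs = V" and ws: "distinct ws" "set ws = V"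
  shows "similar_mat (adjacency_mat vs G) (adjacency_mat ws G)"
proof -
  define n where "n = length vs"
  have len: "length vs = n" "length ws = n"
    using distinct_card[OF vs(1)] distinct_card[OF ws(1)] vs ws by (auto simp: n_def)
  define P :: "'a list \<Rightarrow> 'a list \<Rightarrow> complex mat" where
    "P = (\<lambda>xs ys. mat n n (\<lambda>(i, j). if xs ! i = ys ! j then 1 else 0))"
  have [simp]: "dim_row (P xs ys) = n" "dim_col (P xs ys) = n" for xs ys
    by (auto simp: P_def)
  have pick: "(\<Sum>k = 0..<n. (if x = ys ! k then 1 else 0) * f (ys ! k)) = f x"
    if ys: "distinct ys" "length ys = n" "x \<in> set ys" for x ys and f :: "'a \<Rightarrow> complex"
  proof -
    obtain m where m: "m < n" "ys ! m = x"
      using ys by (auto simp: in_set_conv_nth)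
    have "(\<Sum>k = 0..<n. (if x = ys ! k then 1 else 0) * f (ys ! k)) =
          (\<Sum>k = 0..<n. if k = m then f x else 0)"
      using m ys nth_eq_iff_index_eq[of ys] by (intro sum.cong) auto
    then show ?thesis using m by simp
  qed
  have PP: "P xs ys * P ys xs = 1\<^sub>m n"
    if "distinct xs" "distinct ys" "length xs = n" "length ys = n" "set xs = set ys" for xs ys
  proof (rule eq_matI)
    fix i j assume ij: "i < dim_row (1\<^sub>m n :: complex mat)" "j < dim_col (1\<^sub>m n :: complex mat)"
    then have "(P xs ys * P ys xs) $$ (i, j) =
        (\<Sum>k = 0..<n. (if xs ! i = ys ! k then 1 else 0) * (if ys ! k = xs ! j then 1 else 0))"
      by (simp add: P_def scalar_prod_def)
    also have "\<dots> = (if xs ! i = xs ! j then 1 else 0)"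
      using pick[of ys "xs ! i" "\<lambda>y. if y = xs ! j then 1 else 0"] that ij nth_mem[of i xs]
      by simp
    finally show "(P xs ys * P ys xs) $$ (i, j) = 1\<^sub>m n $$ (i, j)"
      using ij that nth_eq_iff_index_eq[of xs i j] by simp
  qed auto
  have eq: "adjacency_mat vs G = P vs ws * adjacency_mat ws G * P ws vs"
  proof (rule eq_matI)
    fix i j assume "i < dim_row (P vs ws * adjacency_mat ws G * P ws vs)"
      "j < dim_col (P vs ws * adjacency_mat ws G * P ws vs)"
    then have ij: "i < n" "j < n" by auto
    then have mem: "vs ! i \<in> set ws" "vs ! j \<in> set ws"
      using vs ws len nth_mem by blast+
    define a :: "'a \<Rightarrow> 'a \<Rightarrow> complex" where "a = (\<lambda>x y. if (x, y) \<in> parcs G then 1 else 0)"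
    have row: "(P vs ws * adjacency_mat ws G) $$ (i, l) = a (vs ! i) (ws ! l)" if "l < n" for l
    proof -
      have "(P vs ws * adjacency_mat ws G) $$ (i, l) =
          (\<Sum>k = 0..<n. (if vs ! i = ws ! k then 1 else 0) * a (ws ! k) (ws ! l))"
        using ij that len by (simp add: P_def adjacency_mat_def scalar_prod_def a_def)
      then show ?thesis
        using pick[of ws "vs ! i" "\<lambda>x. a x (ws ! l)"] ws len mem by simp
    qed
    have mult: "(M * P ws vs) $$ (i, j) = (\<Sum>l = 0..<n. M $$ (i, l) * P ws vs $$ (l, j))"
      if "M \<in> carrier_mat n n" for M
      using ij that by (auto simp: scalar_prod_def intro!: sum.cong)
    have "P vs ws * adjacency_mat ws G \<in> carrier_mat n n"
      using len by (intro carrier_matI) (simp_all add: adjacency_mat_def)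
    from mult[OF this] have "(P vs ws * adjacency_mat ws G * P ws vs) $$ (i, j) =
        (\<Sum>l = 0..<n. (P vs ws * adjacency_mat ws G) $$ (i, l) * P ws vs $$ (l, j))"
      .
    also have "\<dots> = (\<Sum>l = 0..<n. a (vs ! i) (ws ! l) * (if ws ! l = vs ! j then 1 else 0))"
    proof (intro sum.cong refl arg_cong2[of _ _ _ _ "(*)"])
      fix l assume "l \<in> {0..<n}"
      then have l: "l < n" by simp
      show "(P vs ws * adjacency_mat ws G) $$ (i, l) = a (vs ! i) (ws ! l)"
        by (rule row[OF l])
      show "P ws vs $$ (l, j) = (if ws ! l = vs ! j then 1 else 0)"
        using l ij by (simp add: P_def)
    qed
    also have "\<dots> = (\<Sum>l = 0..<n. (if vs ! j = ws ! l then 1 else 0) * a (vs ! i) (ws ! l))"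
      by (intro sum.cong) auto
    also have "\<dots> = a (vs ! i) (vs ! j)"
      using pick[of ws "vs ! j" "a (vs ! i)"] ws len mem by simp
    finally show "adjacency_mat vs G $$ (i, j) =
        (P vs ws * adjacency_mat ws G * P ws vs) $$ (i, j)"
      using ij len by (simp only: adjacency_mat_def a_def index_mat(1) split)
  qed (auto simp: adjacency_mat_def len)
  show ?thesis
  proof (rule similar_matI)
    show "{adjacency_mat vs G, adjacency_mat ws G, P vs ws, P ws vs} \<subseteq> carrier_mat n n"
      using len by (auto simp: adjacency_mat_def)
    show "P vs ws * P ws vs = 1\<^sub>m n" "P ws vs * P vs ws = 1\<^sub>m n"
      by (rule PP; simp add: vs ws len)+
  qed (rule eq)
qed

lemma graph_energy_eq:
  assumes "distinct vs" "set vs = pverts G"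
  shows "graph_energy G = mat_energy (adjacency_mat vs G)"
proof -
  define ws where "ws = (SOME vs. distinct vs \<and> set vs = pverts G)"
  have ws: "distinct ws \<and> set ws = pverts G"
    unfolding ws_def by (rule someI[of _ vs]) (use assms in simp)
  have carrier: "adjacency_mat us G \<in> carrier_mat (length us) (length us)" for us
    by (simp add: adjacency_mat_def)
  have "char_poly (adjacency_mat ws G) = char_poly (adjacency_mat vs G)"
    using adjacency_mat_similar ws assms by (intro char_poly_similar) blast
  then show ?thesis
    unfolding graph_energy_def ws_def[symmetric] mat_energy_def
    using spectrum_root_char_poly[OF carrier] by simp
qed

end

theory Submission
  imports Defs "HOL-Analysis.Convex"
begin

text \<open>
  A colouring of the complement with \<open>k\<close> colours partitions the vertices into at most \<open>k\<close> cliques.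
  Let \<open>U = I - 2 R\<close>, where \<open>R\<close> projects orthogonally onto the vectors whose entries sum to zero on
  every clique. Since \<open>U\<close> is a contraction, expanding the hermitian adjacency matrix \<open>A\<close> in an
  orthonormal eigenbasis gives \<open>tr (A U) \<le> E(G)\<close>. On the other hand, \<open>U\<close> vanishes between distinct
  cliques, and a clique of size \<open>m\<close> contributes \<open>m (m - 1) \<cdot> 2 / m = 2 (m - 1)\<close> to \<open>tr (A U)\<close>;
  altogether this is at least \<open>2 (n - k)\<close>.
\<close>

section \<open>Algebra of the conjugate transpose\<close>

lemma dim_mat_adjoint [simp]:
  "dim_row (mat_adjoint A) = dim_col A" "dim_col (mat_adjoint A) = dim_row A"
  by (simp_all add: mat_adjoint_def)

lemma mat_adjoint_carrier: "A \<in> carrier_mat n m \<Longrightarrow> mat_adjoint A \<in> carrier_mat m n"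
  by (intro carrier_matI) auto

lemma index_mat_adjoint [simp]:
  "i < dim_col A \<Longrightarrow> j < dim_row A \<Longrightarrow> mat_adjoint A $$ (i, j) = conjugate (A $$ (j, i))"
  by (simp add: mat_adjoint_def mat_of_rows_def)

lemma mat_adjoint_adjoint [simp]: "mat_adjoint (mat_adjoint A) = A"
  by (rule eq_matI) auto

lemma mat_adjoint_mult:
  fixes A :: "'a :: conjugatable_field mat"
  assumes "A \<in> carrier_mat n m" "B \<in> carrier_mat m k"
  shows "mat_adjoint (A * B) = mat_adjoint B * mat_adjoint A"
  using assms
  by (intro eq_matI)
     (auto simp: scalar_prod_def sum_conjugate conjugate_dist_mul mult.commute intro!: sum.cong)

lemma mat_adjoint_four_block:
  assumes "A \<in> carrier_mat n1 m1" "B \<in> carrier_mat n1 m2"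
    "C \<in> carrier_mat n2 m1" "D \<in> carrier_mat n2 m2"
  shows "mat_adjoint (four_block_mat A B C D) =
    four_block_mat (mat_adjoint A) (mat_adjoint C) (mat_adjoint B) (mat_adjoint D)"
  using assms by (intro eq_matI) auto

lemma mat_adjoint_one [simp]: "mat_adjoint (1\<^sub>m n) = (1\<^sub>m n :: complex mat)"
  by (rule eq_matI) auto

lemma mat_adjoint_zero [simp]: "mat_adjoint (0\<^sub>m n m) = (0\<^sub>m m n :: 'a :: conjugatable_field mat)"
  by (rule eq_matI) auto

section \<open>Unitary triangularisation and the spectral theorem\<close>

text \<open>Gram-Schmidt keeps the first vector of a basis completion of \<open>v\<close>, and
  dividing every vector by its length makes the columns orthonormal. The scalar \<open>c\<close>
  absorbs the normalisation of \<open>v\<close>. Used with an eigenvector \<open>v\<close>, this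
  gives one deflation step.\<close>

lemma exists_unitary_with_first_col:
  fixes v :: "complex vec"
  assumes v: "v \<in> carrier_vec n" and v0: "v \<noteq> 0\<^sub>v n"
  obtains W c where "W \<in> carrier_mat n n" "mat_adjoint W * W = 1\<^sub>m n" "col W 0 = c \<cdot>\<^sub>v v"
proof -
  interpret cof_vec_space n "TYPE(complex)" .
  define b where "b = basis_completion v"
  define ws where "ws = gram_schmidt n b"
  note bc = basis_completion[OF v v0, folded b_def]
  have n: "n \<noteq> 0" using v v0 by auto
  obtain vs where bv: "b = v # vs" using bc(6,7) n by (cases b) auto
  have ws: "set ws \<subseteq> carrier_vec n" "corthogonal ws" "length ws = n"
    using gram_schmidt_result[OF bc(2,4,5) refl, folded ws_def] bc(6) by auto
  have hdws: "hd ws = v" using gram_schmidt_hd[OF v, of vs, folded bv] by (simp add: ws_def)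
  have ws0: "ws ! 0 = v" using hdws ws(3) n by (subst hd_conv_nth[symmetric]) auto
  have wsc: "ws ! i \<in> carrier_vec n" if "i < n" for i
    using ws that by (auto simp: subset_iff)
  \<comment> \<open>\<open>N i\<close> is the Euclidean length of \<open>ws ! i\<close>, embedded in
    the complex numbers; the value under the root is shown below to be real and positive.\<close>
  define N where "N i = complex_of_real (sqrt (Re (ws ! i \<bullet>c ws ! i)))" for i
  have NN: "N i * cnj (N i) = ws ! i \<bullet>c ws ! i" "N i \<noteq> 0" if i: "i < n" for i
  proof -
    have "ws ! i \<bullet>c ws ! i \<ge> 0" by (rule conjugate_square_ge_0_vec)
    moreover have "ws ! i \<bullet>c ws ! i \<noteq> 0" using corthogonalD[OF ws(2), of i i] ws(3) i by auto
    ultimately have *: "Im (ws ! i \<bullet>c ws ! i) = 0" "Re (ws ! i \<bullet>c ws ! i) > 0"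
      by (auto simp: less_eq_complex_def complex_eq_iff)
    show "N i * cnj (N i) = ws ! i \<bullet>c ws ! i" "N i \<noteq> 0"
      using * by (auto simp: N_def complex_eq_iff simp flip: of_real_mult)
  qed
  define W where "W = mat n n (\<lambda>(i, j). ws ! j $ i / N j)"
  have W: "W \<in> carrier_mat n n" by (simp add: W_def)
  have "mat_adjoint W * W = 1\<^sub>m n"
  proof (rule eq_matI)
    fix i j assume "i < dim_row (1\<^sub>m n :: complex mat)" "j < dim_col (1\<^sub>m n :: complex mat)"
    then have ij: "i < n" "j < n" by auto
    have "(mat_adjoint W * W) $$ (i, j) = (\<Sum>k = 0..<n. cnj (ws ! i $ k / N i) * (ws ! j $ k / N j))"
      using ij by (simp add: W_def scalar_prod_def)
    also have "\<dots> = (\<Sum>k = 0..<n. ws ! j $ k * cnj (ws ! i $ k)) / (N j * cnj (N i))"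
      by (simp add: sum_divide_distrib mult.commute)
    also have "(\<Sum>k = 0..<n. ws ! j $ k * cnj (ws ! i $ k)) = ws ! j \<bullet>c ws ! i"
      using wsc[OF ij(1)] wsc[OF ij(2)] by (auto simp: scalar_prod_def)
    also have "\<dots> / (N j * cnj (N i)) = 1\<^sub>m n $$ (i, j)"
      using corthogonalD[OF ws(2), of j i] ws(3) ij NN by auto
    finally show "(mat_adjoint W * W) $$ (i, j) = 1\<^sub>m n $$ (i, j)" .
  qed (auto simp: W_def)
  moreover have "col W 0 = (1 / N 0) \<cdot>\<^sub>v v"
    using n ws0 v by (intro eq_vecI) (auto simp: W_def)
  ultimately show ?thesis using that W by blast
qed

text \<open>The library's \<open>schur_decomposition\<close> cannot be used here: its conjugating matrix is a product
  of matrices with orthogonal but not normalised columns, hence not unitary.\<close>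

lemma schur_unitary:
  fixes A :: "complex mat"
  assumes "A \<in> carrier_mat n n" "char_poly A = (\<Prod>e \<leftarrow> es. [:- e, 1:])"
  shows "\<exists>P \<in> carrier_mat n n. mat_adjoint P * P = 1\<^sub>m n \<and>
    upper_triangular (mat_adjoint P * A * P) \<and> diag_mat (mat_adjoint P * A * P) = es"
  using assms
proof (induction es arbitrary: n A)
  case Nil
  then have "n = 0" using degree_monic_char_poly[of A n] by simp
  then show ?case using Nil by (intro bexI[of _ "1\<^sub>m n"]) (auto simp: diag_mat_def)
next
  case (Cons e es n A)
  define m where "m = n - 1"
  note A = Cons.prems(1)
  have cp: "char_poly A = [:-e, 1:] * (\<Prod>e \<leftarrow> es. [:- e, 1:])" using Cons.prems by simp
  \<comment> \<open>Comparing degrees forces \<open>n\<close> to be positive, so a 1 x 1 block can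
    be split off.\<close>
  have "monic (\<Prod>e\<leftarrow> es. [:- e, 1:])" by (rule monic_prod_list) auto
  then have "degree (char_poly A) = Suc (degree (\<Prod>e\<leftarrow> es. [:- e, 1:]))"
    unfolding cp by (subst degree_mult_eq) auto
  then have n: "n = Suc m" using degree_monic_char_poly[OF A] by (simp add: m_def)
  have "eigenvalue A e" unfolding eigenvalue_root_char_poly[OF A] cp by simp
  then obtain v where v: "v \<in> carrier_vec n" "v \<noteq> 0\<^sub>v n" and Av: "A *\<^sub>v v = e \<cdot>\<^sub>v v"
    using A by (auto simp: eigenvalue_def eigenvector_def)
  obtain W c where W: "W \<in> carrier_mat n n" and WW: "mat_adjoint W * W = 1\<^sub>m n"
    and col0: "col W 0 = c \<cdot>\<^sub>v v"
    using exists_unitary_with_first_col[OF v] by blast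
  \<comment> \<open>Deflation: the first column of \<open>W\<close> is fixed up to the factor
    \<open>e\<close> by \<open>A\<close>, so the first column of \<open>A'\<close> is
    \<open>e\<close> times the first unit vector and \<open>A'\<close> is block upper triangular
    with diagonal blocks \<open>e\<close> and \<open>A3\<close>.\<close>
  define A' where "A' = mat_adjoint W * A * W"
  have W': "mat_adjoint W \<in> carrier_mat n n" using W by (rule mat_adjoint_carrier)
  have A': "A' \<in> carrier_mat n n" using W A W' by (auto simp: A'_def)
  have WW': "W * mat_adjoint W = 1\<^sub>m n" using mat_mult_left_right_inverse[OF W' W WW] .
  have Acol: "A *\<^sub>v col W 0 = e \<cdot>\<^sub>v col W 0"
    using A v Av by (simp add: col0 mult_mat_vec smult_smult_assoc mult.commute)
  have A'0: "A' $$ (i, 0) = (if i = 0 then e else 0)" if i: "i < n" for i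
  proof -
    have "A' = mat_adjoint W * (A * W)" using assoc_mult_mat[OF W' A W] by (simp add: A'_def)
    then have "A' $$ (i, 0) = row (mat_adjoint W) i \<bullet> col (A * W) 0"
      using i n W A by simp
    also have "col (A * W) 0 = e \<cdot>\<^sub>v col W 0"
      using col_mult2[OF A W] n Acol by simp
    also have "row (mat_adjoint W) i \<bullet> \<dots> = e * (row (mat_adjoint W) i \<bullet> col W 0)"
      using W i n by (intro scalar_prod_smult_right) auto
    also have "row (mat_adjoint W) i \<bullet> col W 0 = (mat_adjoint W * W) $$ (i, 0)"
      using W i n by simp
    finally show ?thesis using WW i n by simp
  qed
  obtain A1 A2 A0 A3 where split: "split_block A' 1 1 = (A1, A2, A0, A3)"
    by (cases "split_block A' 1 1") auto
  have dims: "dim_row A' = 1 + m" "dim_col A' = 1 + m" using A' n by auto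
  note sb = split_block[OF split dims]
  have A1: "A1 = mat 1 1 (\<lambda>_. e)" and A0: "A0 = 0\<^sub>m m 1"
    using split A'0 n A' by (auto simp: split_block_def Let_def intro!: eq_matI)
  have "similar_mat A' A"
    by (rule similar_matI[of _ _ "mat_adjoint W" W n]) (use W A A' WW WW' W' in \<open>auto simp: A'_def\<close>)
  \<comment> \<open>Cancelling the linear factor of \<open>e\<close> on both sides leaves the
    characteristic polynomial of \<open>A3\<close>, as the induction hypothesis requires.\<close>
  then have "[:-e, 1:] * (\<Prod>e \<leftarrow> es. [:- e, 1:]) = char_poly A'"
    using cp char_poly_similar by metis
  also have "\<dots> = char_poly A1 * char_poly A3"
    unfolding sb(5) A0 by (rule char_poly_four_block_zeros_col[OF sb(1,2,4)])
  also have "char_poly A1 = [:-e, 1:]"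
    by (simp add: A1 char_poly_defs det_def sign_def)
  finally have "char_poly A3 = (\<Prod>e \<leftarrow> es. [:- e, 1:])"
    by (metis mult_cancel_left pCons_eq_0_iff zero_neq_one)
  from Cons.IH[OF sb(4) this] obtain Q where Q: "Q \<in> carrier_mat m m" "mat_adjoint Q * Q = 1\<^sub>m m"
    "upper_triangular (mat_adjoint Q * A3 * Q)" "diag_mat (mat_adjoint Q * A3 * Q) = es"
    by blast
  \<comment> \<open>\<open>F\<close> is the direct sum of 1 and \<open>Q\<close>: conjugation by it
    triangularises \<open>A3\<close> and preserves the first column of \<open>A'\<close>. The
    unitary sought is \<open>W * F\<close>.\<close>
  define F where "F = four_block_mat (1\<^sub>m 1) (0\<^sub>m 1 m) (0\<^sub>m m 1) Q"
  have F: "F \<in> carrier_mat n n" using Q n by (auto simp: F_def)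
  have F': "mat_adjoint F \<in> carrier_mat n n" using F by (rule mat_adjoint_carrier)
  have Q': "mat_adjoint Q \<in> carrier_mat m m" using Q(1) by (rule mat_adjoint_carrier)
  have F_adj: "mat_adjoint F = four_block_mat (1\<^sub>m 1) (0\<^sub>m 1 m) (0\<^sub>m m 1) (mat_adjoint Q)"
    unfolding F_def using Q by (subst mat_adjoint_four_block[of _ 1 1 _ m _ m]) auto
  have FF: "mat_adjoint F * F = 1\<^sub>m n"
    unfolding F_adj unfolding F_def using Q Q' n
    by (subst mult_four_block_mat[of _ 1 1 _ m _ m _ _ 1 _ m]) auto
  have FA: "mat_adjoint F * A' = four_block_mat A1 A2 A0 (mat_adjoint Q * A3)"
    unfolding F_adj sb(5) using Q(1) Q' sb(1-4) A0
    by (subst mult_four_block_mat[of _ 1 1 _ m _ m _ _ 1 _ m]) auto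
  have FAF: "mat_adjoint F * A' * F = four_block_mat A1 (A2 * Q) (0\<^sub>m m 1) (mat_adjoint Q * A3 * Q)"
    unfolding FA unfolding F_def using Q(1) Q' sb(1-4) A0 
    by (subst mult_four_block_mat[of _ 1 1 _ m _ m _ _ 1 _ m]) auto
  have QQ: "mat_adjoint Q * A3 * Q \<in> carrier_mat m m" using Q(1) Q' sb(4) by auto
  have adj: "mat_adjoint (W * F) = mat_adjoint F * mat_adjoint W"
    by (rule mat_adjoint_mult[OF W F])
  have "mat_adjoint (W * F) * A * (W * F) = mat_adjoint F * A' * F"
    unfolding adj A'_def using W F W' F' A by (simp add: assoc_mult_mat[of _ n n _ n _ n])
  moreover have "mat_adjoint (W * F) * (W * F) = mat_adjoint F * (mat_adjoint W * W) * F"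
    unfolding adj using W F W' F' by (simp add: assoc_mult_mat[of _ n n _ n _ n])
  then have "mat_adjoint (W * F) * (W * F) = 1\<^sub>m n"
    unfolding WW using FF right_mult_one_mat[OF F'] by simp
  moreover have "upper_triangular (mat_adjoint F * A' * F)"
    unfolding FAF by (rule upper_triangular_four_block[OF _ QQ _ Q(3)]) (auto simp: A1)
  moreover have "diag_mat (mat_adjoint F * A' * F) = e # es"
    unfolding FAF using diag_four_block_mat[OF sb(1) QQ] Q(4) by (simp add: A1 diag_mat_def)
  ultimately show ?case using W F by (intro bexI[of _ "W * F"]) auto
qed

text \<open>Unitary conjugation preserves hermitian matrices, and a hermitian upper triangular
  matrix is diagonal. The vectors \<open>p k\<close> are the columns of the conjugating unitary,
  that is, unit eigenvectors, and the second conclusion is the resulting sum of rank one terms, read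
  entrywise.\<close>

lemma hermitian_spectral_decomposition:
  fixes A :: "complex mat"
  assumes A: "A \<in> carrier_mat n n" and herm: "mat_adjoint A = A"
    and cp: "char_poly A = (\<Prod>e \<leftarrow> es. [:- e, 1:])"
  obtains p :: "nat \<Rightarrow> nat \<Rightarrow> complex"
  where "\<And>k. k < n \<Longrightarrow> (\<Sum>i<n. (cmod (p k i))\<^sup>2) = 1"
    and "\<And>i j. i < n \<Longrightarrow> j < n \<Longrightarrow> A $$ (i, j) = (\<Sum>k<n. es ! k * (p k i * cnj (p k j)))"
proof -
  obtain P where P: "P \<in> carrier_mat n n" "mat_adjoint P * P = 1\<^sub>m n"
    and ut: "upper_triangular (mat_adjoint P * A * P)"
    and diag: "diag_mat (mat_adjoint P * A * P) = es"
    using schur_unitary[OF A cp] by blast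
  define B where "B = mat_adjoint P * A * P"
  have P': "mat_adjoint P \<in> carrier_mat n n" using P(1) by (rule mat_adjoint_carrier)
  have PP': "P * mat_adjoint P = 1\<^sub>m n" using mat_mult_left_right_inverse[OF P' P(1,2)] .
  have B: "B \<in> carrier_mat n n" using P P' A by (auto simp: B_def)
  have "mat_adjoint B = B"
    unfolding B_def using P(1) P' A herm
    by (simp add: mat_adjoint_mult[of _ n n _ n] assoc_mult_mat[of _ n n _ n _ n])
  then have sym: "B $$ (i, j) = cnj (B $$ (j, i))" if "i < n" "j < n" for i j
    using that B index_mat_adjoint[of i B j] by simp
  have Bij: "B $$ (i, j) = (if i = j then es ! i else 0)" if "i < n" "j < n" for i j
  proof (cases i j rule: linorder_cases)
    case equal
    then show ?thesis using diag that B by (auto simp: diag_mat_def B_def[symmetric])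
  next
    case less
    then have "B $$ (j, i) = 0" using ut that B by (auto simp: B_def[symmetric])
    then show ?thesis using less sym[OF that] by simp
  next
    case greater
    then show ?thesis using ut that B by (auto simp: B_def[symmetric])
  qed
  have "P * B * mat_adjoint P = (P * mat_adjoint P) * A * (P * mat_adjoint P)"
    unfolding B_def using P(1) P' A by (simp add: assoc_mult_mat[of _ n n _ n _ n])
  then have AB: "A = P * B * mat_adjoint P" using PP' A by simp
  have PB: "(P * B) $$ (i, k) = es ! k * P $$ (i, k)" if ik: "i < n" "k < n" for i k
  proof -
    have "(P * B) $$ (i, k) = (\<Sum>l = 0..<n. P $$ (i, l) * B $$ (l, k))"
      using P(1) B ik by (simp add: scalar_prod_def)
    also have "\<dots> = (\<Sum>l = 0..<n. if l = k then es ! k * P $$ (i, k) else 0)"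
      using ik by (intro sum.cong) (auto simp: Bij)
    finally show ?thesis using ik by simp
  qed
  show ?thesis
  proof (rule that[of "\<lambda>k i. P $$ (i, k)"])
    fix k assume k: "k < n"
    have "complex_of_real (\<Sum>i<n. (cmod (P $$ (i, k)))\<^sup>2) = (mat_adjoint P * P) $$ (k, k)"
      using P(1) k
      by (simp add: scalar_prod_def complex_norm_square mult.commute lessThan_atLeast0 del: of_real_power)
    also have "\<dots> = 1" using P(2) k by simp
    finally show "(\<Sum>i<n. (cmod (P $$ (i, k)))\<^sup>2) = 1"
      unfolding of_real_eq_1_iff .
  next
    fix i j assume ij: "i < n" "j < n"
    have "A $$ (i, j) = row (P * B) i \<bullet> col (mat_adjoint P) j"
      using ij P(1) B by (subst AB) simp
    also have "\<dots> = (\<Sum>k = 0..<n. (P * B) $$ (i, k) * mat_adjoint P $$ (k, j))"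
      using ij P(1) B by (simp only: scalar_prod_def dim_col dim_mat_adjoint) (auto intro!: sum.cong)
    also have "\<dots> = (\<Sum>k<n. es ! k * (P $$ (i, k) * cnj (P $$ (j, k))))"
      using ij P(1) by (intro sum.cong) (auto simp: PB lessThan_atLeast0)
    finally show "A $$ (i, j) = (\<Sum>k<n. es ! k * (P $$ (i, k) * cnj (P $$ (j, k))))" .
  qed
qed

section \<open>The energy as an upper bound for traces\<close>

text \<open>The list \<open>es\<close> is the multiset of roots of the characteristic polynomial, so
  the algebraic multiplicity of \<open>z\<close> is its number of occurrences in
  \<open>es\<close>.\<close>

lemma mat_energy_eq_sum_list:
  assumes A: "A \<in> carrier_mat n n" and cp: "char_poly A = (\<Prod>e \<leftarrow> es. [:- e, 1:])"
  shows "mat_energy A = (\<Sum>e \<leftarrow> es. cmod e)"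
proof -
  have nz: "char_poly A \<noteq> 0" using cp by (auto simp: prod_list_zero_iff)
  have "proots (\<Prod>e \<leftarrow> es. [:- e, 1:]) = mset es"
  proof (induction es)
    case (Cons e es)
    have "(\<Prod>e \<leftarrow> es. [:- e, 1:]) \<noteq> 0" by (auto simp: prod_list_zero_iff)
    then show ?case using Cons by (simp add: proots_mult del: mult_pCons_left)
  qed simp
  then have pr: "proots (char_poly A) = mset es" by (simp add: cp)
  have spec: "spectrum A = set es"
    using spectrum_root_char_poly[OF A] set_count_proots[OF nz] pr by simp
  have "Polynomial.order z (char_poly A) = count_list es z" for z
    using count_proots[OF nz] pr by (metis count_mset)
  then have "mat_energy A = (\<Sum>z \<in> set es. real (count_list es z) * cmod z)"
    by (simp add: mat_energy_def spec)
  also have "\<dots> = (\<Sum>e \<leftarrow> es. cmod e)"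
  proof -
    \<comment> \<open>The index set is generalised to a finite superset \<open>X\<close> that stays
      fixed while the list shrinks in the induction.\<close>
    have "(\<Sum>z\<in>X. real (count_list xs z) * cmod z) = (\<Sum>e \<leftarrow> xs. cmod e)"
      if "finite X" "set xs \<subseteq> X" for X xs
      using that(2)
    proof (induction xs)
      case (Cons a xs)
      have "(\<Sum>z\<in>X. real (count_list (a # xs) z) * cmod z) =
          (\<Sum>z\<in>X. (if a = z then cmod a else 0) + real (count_list xs z) * cmod z)"
        by (intro sum.cong) (auto simp: algebra_simps)
      then show ?case using Cons that(1) by (simp add: sum.distrib)
    qed simp
    then show ?thesis by simp
  qed
  finally show ?thesis .
qed

text \<open>In the eigenbasis the trace of \<open>A U\<close> is the sum of the eigenvalues weighted
  by the values of the quadratic form of \<open>U\<close> at unit eigenvectors, and the hypothesis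
  bounds these values by 1 in modulus.\<close>

lemma energy_ge_trace:
  fixes A :: "complex mat" and U :: "nat \<Rightarrow> nat \<Rightarrow> complex"
  assumes A: "A \<in> carrier_mat n n" and herm: "mat_adjoint A = A"
    and U: "\<And>f. cmod (\<Sum>i<n. \<Sum>j<n. cnj (f i) * U i j * f j) \<le> (\<Sum>i<n. (cmod (f i))\<^sup>2)"
  shows "cmod (\<Sum>i<n. \<Sum>j<n. A $$ (i, j) * U j i) \<le> mat_energy A"
proof -
  obtain es where cp: "char_poly A = (\<Prod>e \<leftarrow> es. [:- e, 1:])" and len: "length es = n"
    using char_poly_factorized[OF A] by blast
  obtain p where p: "\<And>k. k < n \<Longrightarrow> (\<Sum>i<n. (cmod (p k i))\<^sup>2) = 1"
    and Ap: "\<And>i j. i < n \<Longrightarrow> j < n \<Longrightarrow> A $$ (i, j) = (\<Sum>k<n. es ! k * (p k i * cnj (p k j)))"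
    using hermitian_spectral_decomposition[OF A herm cp] by blast
  \<comment> \<open>\<open>T k\<close> is the quadratic form of \<open>U\<close> at
    \<open>p k\<close>; the interchanges below move the sum over \<open>k\<close> outermost.\<close>
  define T where "T k = (\<Sum>j<n. \<Sum>i<n. cnj (p k j) * U j i * p k i)" for k
  have "(\<Sum>i<n. \<Sum>j<n. A $$ (i, j) * U j i) =
      (\<Sum>i<n. \<Sum>j<n. \<Sum>k<n. es ! k * (cnj (p k j) * U j i * p k i))"
    by (simp add: Ap sum_distrib_left sum_distrib_right mult_ac)
  also have "\<dots> = (\<Sum>j<n. \<Sum>i<n. \<Sum>k<n. es ! k * (cnj (p k j) * U j i * p k i))"
    by (rule sum.swap)
  also have "\<dots> = (\<Sum>j<n. \<Sum>k<n. \<Sum>i<n. es ! k * (cnj (p k j) * U j i * p k i))"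
    by (intro sum.cong sum.swap refl)
  also have "\<dots> = (\<Sum>k<n. \<Sum>j<n. \<Sum>i<n. es ! k * (cnj (p k j) * U j i * p k i))"
    by (rule sum.swap)
  also have "\<dots> = (\<Sum>k<n. es ! k * T k)"
    by (simp add: T_def sum_distrib_left)
  also have "cmod \<dots> \<le> (\<Sum>k<n. cmod (es ! k))"
  proof (rule sum_norm_le)
    fix k assume "k \<in> {..<n}"
    then have "cmod (T k) \<le> 1" using U[of "p k"] p[of k] by (simp add: T_def)
    then show "cmod (es ! k * T k) \<le> cmod (es ! k)"
      by (simp add: norm_mult mult_left_le)
  qed
  also have "\<dots> = mat_energy A"
    using mat_energy_eq_sum_list[OF A cp] len
    by (simp add: sum_list_sum_nth lessThan_atLeast0)
  finally show ?thesis .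
qed

section \<open>Averaging over the fibres of a map\<close>

text \<open>The kernel below is \<open>U = 2 J / m - I\<close> on every fibre of size \<open>m\<close>, that is
  \<open>U = I - 2 R\<close>, where \<open>R\<close> is the orthogonal projection onto the functions whose sum over every
  fibre of \<open>c\<close> vanishes.\<close>

lemma fibre_reflection_contraction:
  fixes c :: "'i \<Rightarrow> 'b" and f :: "'i \<Rightarrow> complex"
  assumes fin: "finite I"
  defines "m \<equiv> \<lambda>q. real (card {i \<in> I. c i = q})"
  shows "cmod (\<Sum>i\<in>I. \<Sum>j\<in>I. cnj (f i) *
      ((if c i = c j then of_real (2 / m (c i)) else 0) - (if i = j then 1 else 0)) * f j)
    \<le> (\<Sum>i\<in>I. (cmod (f i))\<^sup>2)" (is "cmod ?L \<le> ?s")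
proof -
  define S where "S q = (\<Sum>i | i \<in> I \<and> c i = q. f i)" for q
  \<comment> \<open>\<open>t\<close> is the squared norm of the projection of \<open>f\<close> onto
    the functions constant on fibres. The form equals \<open>2 * t - ?s\<close>, and 0 \<le> t \<le>
    \<open>?s\<close> bounds its modulus by \<open>?s\<close>.\<close>
  define t where "t = (\<Sum>q\<in>c ` I. (cmod (S q))\<^sup>2 / m q)"
  have inner: "(\<Sum>j\<in>I. cnj (f i) *
      ((if c i = c j then of_real (2 / m (c i)) else 0) - (if i = j then 1 else 0)) * f j) =
      cnj (f i) * of_real (2 / m (c i)) * S (c i) - of_real ((cmod (f i))\<^sup>2)" if "i \<in> I" for i
  proof -
    have "(\<Sum>j\<in>I. cnj (f i) *
      ((if c i = c j then of_real (2 / m (c i)) else 0) - (if i = j then 1 else 0)) * f j) =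
      (\<Sum>j\<in>I. (if c j = c i then cnj (f i) * of_real (2 / m (c i)) * f j else 0)
         - (if i = j then cnj (f i) * f j else 0))"
      by (intro sum.cong) (auto simp: algebra_simps)
    also have "\<dots> = (\<Sum>j | j \<in> I \<and> c j = c i. cnj (f i) * of_real (2 / m (c i)) * f j) - cnj (f i) * f i"
      using that fin by (subst sum.inter_filter) (simp_all add: sum_subtractf del: of_real_divide)
    also have "\<dots> = cnj (f i) * of_real (2 / m (c i)) * S (c i) - of_real ((cmod (f i))\<^sup>2)"
      by (simp add: S_def sum_distrib_left complex_norm_square mult.commute del: of_real_power)
    finally show ?thesis .
  qed
  have "(\<Sum>i\<in>I. cnj (f i) * of_real (2 / m (c i)) * S (c i)) =
      (\<Sum>q\<in>c ` I. \<Sum>i | i \<in> I \<and> c i = q. cnj (f i) * of_real (2 / m (c i)) * S (c i))"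
    by (rule sum.image_gen[OF fin])
  also have "\<dots> = (\<Sum>q\<in>c ` I. cnj (S q) * (of_real (2 / m q) * S q))"
    by (intro sum.cong refl) (simp add: S_def sum_distrib_right mult.assoc del: of_real_divide)
  also have "\<dots> = (\<Sum>q\<in>c ` I. of_real (2 * ((cmod (S q))\<^sup>2 / m q)))"
    by (intro sum.cong refl) (simp add: complex_norm_square del: of_real_power)
  finally have "?L = of_real (2 * t - ?s)"
    by (simp add: inner sum_subtractf t_def sum_distrib_left)
  moreover have "0 \<le> t"
    by (auto simp: t_def m_def intro!: sum_nonneg)
  moreover have "t \<le> ?s"
  proof -
    have "(cmod (S q))\<^sup>2 / m q \<le> (\<Sum>i | i \<in> I \<and> c i = q. (cmod (f i))\<^sup>2)" if "q \<in> c ` I" for q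
    proof -
      have pos: "m q > 0" using that fin by (auto simp: m_def card_gt_0_iff)
      \<comment> \<open>Cauchy-Schwarz on one fibre, after the triangle inequality.\<close>
      have "(cmod (S q))\<^sup>2 \<le> (\<Sum>i | i \<in> I \<and> c i = q. cmod (f i))\<^sup>2"
        unfolding S_def by (intro power_mono norm_sum) auto
      also have "\<dots> \<le> (\<Sum>i | i \<in> I \<and> c i = q. (cmod (f i))\<^sup>2) * m q"
        unfolding m_def by (rule sum_squared_le_sum_of_squares)
      finally show ?thesis using pos by (simp add: divide_le_eq)
    qed
    then have "t \<le> (\<Sum>q\<in>c ` I. \<Sum>i | i \<in> I \<and> c i = q. (cmod (f i))\<^sup>2)"
      unfolding t_def by (rule sum_mono)
    also have "\<dots> = ?s" by (rule sum.image_gen[OF fin, symmetric])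
    finally show ?thesis .
  qed
  ultimately show ?thesis by (simp only: norm_of_real)
qed

text \<open>A nonempty fibre of size \<open>m\<close> contributes \<open>m\<close> terms equal to
  \<open>1 / m\<close>, hence exactly 1.\<close>

lemma sum_inverse_fibre_card:
  fixes c :: "'i \<Rightarrow> 'b"
  assumes "finite I"
  shows "(\<Sum>i\<in>I. 1 / real (card {j \<in> I. c j = c i})) = real (card (c ` I))"
proof -
  have "(\<Sum>i\<in>I. 1 / real (card {j \<in> I. c j = c i})) =
      (\<Sum>q\<in>c ` I. \<Sum>i | i \<in> I \<and> c i = q. 1 / real (card {j \<in> I. c j = c i}))"
    by (rule sum.image_gen[OF assms])
  also have "\<dots> = (\<Sum>q\<in>c ` I. 1)"
    using assms by (intro sum.cong refl) (auto simp: card_eq_0_iff)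
  finally show ?thesis by simp
qed

section \<open>From a clique partition to the energy bound\<close>

theorem theorem10:
  fixes G :: "'a pair_pre_digraph" and n :: nat
  assumes "pair_graph G" and "card (pverts G) = n"
  shows "graph_energy G \<ge> 2 * (real n - real (chromatic_number (complement G)))"
proof -
  interpret pair_graph G by fact
  obtain vs where vs: "distinct vs" "set vs = pverts G"
    using finite_distinct_list[OF pair_finite_verts] by blast
  have len: "length vs = n" using distinct_card[OF vs(1)] vs(2) assms(2) by simp
  define k where "k = chromatic_number (complement G)"
  \<comment> \<open>Distinct vertices of equal colour are not adjacent in the complement, hence
    adjacent in \<open>G\<close>: colour classes are cliques.\<close>
  obtain col where col: "col ` pverts G \<subseteq> {..<k}"
    and mono: "\<And>u v. u \<in> pverts G \<Longrightarrow> v \<in> pverts G \<Longrightarrow> u \<noteq> v \<Longrightarrow> col u = col v \<Longrightarrow> (u, v) \<in> parcs G"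
    using colorable_chromatic_number[OF pair_graph_complement[OF assms(1)]]
    by (auto simp: colorable_def complement_def k_def)
  define c where "c i = col (vs ! i)" for i
  define m where "m q = real (card {i \<in> {..<n}. c i = q})" for q
  define A where "A = adjacency_mat vs G"
  define U :: "nat \<Rightarrow> nat \<Rightarrow> complex" where
    "U i j = (if c i = c j then of_real (2 / m (c i)) else 0) - (if i = j then 1 else 0)" for i j
  have A: "A \<in> carrier_mat n n" by (simp add: A_def adjacency_mat_def len)
  have Aij: "A $$ (i, j) = (if (vs ! i, vs ! j) \<in> parcs G then 1 else 0)" if "i < n" "j < n" for i j
    using that by (simp add: A_def adjacency_mat_def len)
  have vsin: "vs ! i \<in> pverts G" if "i < n" for i using that vs len nth_mem by blast
  have arc_sym: "(u, v) \<in> parcs G \<longleftrightarrow> (v, u) \<in> parcs G" for u v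
    using arcs_symmetric by blast
  have herm: "mat_adjoint A = A"
    using A arc_sym by (intro eq_matI) (auto simp: Aij)
  \<comment> \<open>Between classes \<open>U\<close> vanishes, and inside a class the off-diagonal
    entries of \<open>A\<close> are 1. On the diagonal \<open>A\<close> is 0, so there the two terms
    on the right cancel.\<close>
  have entry: "A $$ (i, j) * U j i =
      (if c j = c i then of_real (2 / m (c i)) else 0) - (if j = i then of_real (2 / m (c i)) else 0)"
    if ij: "i < n" "j < n" for i j
  proof (cases "i = j")
    case True
    then show ?thesis using no_loops' ij by (auto simp: Aij)
  next
    case False
    then have "vs ! i \<noteq> vs ! j" using ij vs(1) len by (simp add: nth_eq_iff_index_eq)
    then show ?thesis using False mono[of "vs ! i" "vs ! j"] ij vsin by (auto simp: Aij U_def c_def)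
  qed
  \<comment> \<open>The class of \<open>i\<close> supplies \<open>m (c i)\<close> terms
    \<open>2 / m (c i)\<close>, from which the diagonal one is removed.\<close>
  have "(\<Sum>j<n. A $$ (i, j) * U j i) = of_real (2 - 2 / m (c i))" if i: "i < n" for i
  proof -
    have "m (c i) > 0" using i by (auto simp: m_def card_gt_0_iff)
    then have "m (c i) * (2 / m (c i)) = 2" by simp
    moreover have "(\<Sum>j<n. A $$ (i, j) * U j i) =
        (\<Sum>j | j \<in> {..<n} \<and> c j = c i. of_real (2 / m (c i))) - of_real (2 / m (c i))"
      using i by (subst sum.inter_filter) (simp_all add: entry sum_subtractf del: of_real_divide)
    moreover have "(\<Sum>j | j \<in> {..<n} \<and> c j = c i. complex_of_real (2 / m (c i))) =
        of_real (m (c i) * (2 / m (c i)))"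
      by (simp add: m_def)
    ultimately show ?thesis by simp
  qed
  then have "(\<Sum>i<n. \<Sum>j<n. A $$ (i, j) * U j i) = of_real (\<Sum>i<n. 2 - 2 * (1 / m (c i)))"
    by simp
  also have "(\<Sum>i<n. 2 - 2 * (1 / m (c i))) = 2 * (real n - real (card (c ` {..<n})))"
    using sum_inverse_fibre_card[of "{..<n}" c]
    by (simp only: sum_subtractf sum_distrib_left[symmetric] m_def) simp
  finally have tr: "(\<Sum>i<n. \<Sum>j<n. A $$ (i, j) * U j i) =
      of_real (2 * (real n - real (card (c ` {..<n}))))" .
  \<comment> \<open>The trace counts the colours that occur; there are at most \<open>k\<close> of
    them.\<close>
  have "c ` {..<n} \<subseteq> {..<k}" using col vsin by (auto simp: c_def)
  then have "card (c ` {..<n}) \<le> k" using card_mono[of "{..<k}"] by fastforce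
  then have "2 * (real n - real k) \<le> 2 * (real n - real (card (c ` {..<n})))" by simp
  also have "\<dots> \<le> cmod (\<Sum>i<n. \<Sum>j<n. A $$ (i, j) * U j i)"
    unfolding tr norm_of_real by (rule abs_ge_self)
  also have "\<dots> \<le> mat_energy A"
    using fibre_reflection_contraction[OF finite_lessThan[of n], where c = c]
    by (intro energy_ge_trace[OF A herm]) (simp only: U_def m_def)
  also have "\<dots> = graph_energy G" using graph_energy_eq[OF vs] by (simp add: A_def)
  finally show ?thesis by (simp add: k_def)
qed

end
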